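(* Let $F_n$ be the free group of rank $n$ with basis $x_1,\dots,x_n$. (1) For any $k\ge 1$ (and any $m\ge 2$), $\mathcal{A}_{F_n}(k)\subset\mathcal{D}^m_{F_n}(k)$. (2) For any $k\ge 1$ and $m\ge 2$, $\mathcal{D}^{m+1}_{F_n}(k)\subset\mathcal{D}^m_{F_n}(k)$.
   Context: For a group $G$ generated by $x_1,\dots,x_n$ and $m\ge 2$, let $R^m(G)=\mathrm{Hom}(G,\mathrm{SL}(m,\mathbf{C}))$ and let $\mathcal{F}(R^m(G),\mathbf{C})$ be the $\mathbf{C}$-algebra of all functions $R^m(G)\to\mathbf{C}$ with pointwise operations. For $x\in G$ and $1\le i,j\le m$, let $a_{ij}(x)$ be the function $\rho\mapsto$ the $(i,j)$-component of $\rho(x)$. Let $\mathfrak{R}^m_{\mathbf{Q}}(G)$ be the $\mathbf{Q}$-subalgebra generated by all $a_{ij}(x)$, $x\in G$, $1\le i,j\le m$. Put $s_{ij}(x)=a_{ij}(x)-\delta_{ij}$ and let $\mathfrak{J}_G$ be the ideal of $\mathfrak{R}^m_{\mathbf{Q}}(G)$ generated by $s_{ij}(x_l)$ for $1\le i,j\le m$, $1\le l\le n$ (it depends on $m$). $\mathrm{Aut}\,G$ acts on $G$ from the right, written $x^\sigma$, and acts from the right on $\mathfrak{R}^m_{\mathbf{Q}}(G)$ by algebra automorphisms with $a_{ij}(x)^\sigma=a_{ij}(x^\sigma)$; the ideal $\mathfrak{J}_G$ and its powers are invariant. Define $$\mathcal{D}^m_G(k)=\mathrm{Ker}\big(\mathrm{Aut}\,G\to\mathrm{Aut}(\mathfrak{J}_G/\mathfrak{J}_G^{k+1})\big).$$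 Let $\Gamma_G(1)=G$, $\Gamma_G(k)=[\Gamma_G(k-1),G]$ be the lower central series, and define $$\mathcal{A}_G(k)=\mathrm{Ker}\big(\mathrm{Aut}\,G\to\mathrm{Aut}(G/\Gamma_G(k+1))\big).$$ *)

theory Defs
  imports
    "HOL-Algebra.Bij"
    "HOL-Algebra.Ideal_Product"
    "HOL-Algebra.Generated_Groups"
    "HOL-Algebra.Subrings"
    "Jordan_Normal_Form.Determinant"
begin

section \<open>Free groups\<close>

text \<open>
  A letter \<open>(l, True)\<close> stands for the generator with index \<open>l\<close> and \<open>(l, False)\<close> for its
  inverse.  Generators are indexed by \<open>0, \<dots>, n - 1\<close>.  The free group of rank \<open>n\<close> consists
  of the reduced words; two words are multiplied by concatenation followed by free reduction.
\<close>

type_synonym letter = "nat \<times> bool"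

definition letter_inv :: "letter \<Rightarrow> letter" where
  "letter_inv a = (fst a, \<not> snd a)"

fun reduced :: "letter list \<Rightarrow> bool" where
  "reduced [] = True"
| "reduced [a] = True"
| "reduced (a # b # w) = (b \<noteq> letter_inv a \<and> reduced (b # w))"

fun cancel_cons :: "letter \<Rightarrow> letter list \<Rightarrow> letter list" where
  "cancel_cons a [] = [a]"
| "cancel_cons a (b # w) = (if b = letter_inv a then w else a # b # w)"

definition free_group :: "nat \<Rightarrow> letter list monoid" where
  "free_group n =
    \<lparr>carrier = {w. reduced w \<and> fst ` set w \<subseteq> {..<n}},
     monoid.mult = (\<lambda>u v. foldr cancel_cons u v),
     one = []\<rparr>"

definition free_gens :: "nat \<Rightarrow> letter list set" where
  "free_gens n = (\<lambda>l. [(l, True)]) ` {..<n}"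

lemma letter_inv_simps [simp]:
  "letter_inv (letter_inv a) = a" "letter_inv a \<noteq> a" "a \<noteq> letter_inv a"
  "fst (letter_inv a) = fst a"
  by (auto simp: letter_inv_def prod_eq_iff)

lemma reduced_tl: "reduced (a # w) \<Longrightarrow> reduced w"
  by (cases w) auto

lemma reduced_cancel_cons: "reduced w \<Longrightarrow> reduced (cancel_cons a w)"
  by (cases w) (auto dest: reduced_tl)

lemma set_cancel_cons: "set (cancel_cons a w) \<subseteq> insert a (set w)"
  by (cases w) auto

lemma cancel_cons_reduced: "reduced (a # w) \<Longrightarrow> cancel_cons a w = a # w"
  by (cases w) auto

lemma cancel_cons_inv:
  assumes "reduced w"
  shows "cancel_cons a (cancel_cons (letter_inv a) w) = w"
proof (cases w)
  case (Cons b v)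
  then show ?thesis
    using assms by (cases v) auto
qed auto

lemma reduced_mult: "reduced v \<Longrightarrow> reduced (foldr cancel_cons u v)"
  by (induction u) (auto intro: reduced_cancel_cons)

lemma set_mult_letters: "set (foldr cancel_cons u v) \<subseteq> set u \<union> set v"
proof (induction u)
  case (Cons a u)
  then show ?case
    using set_cancel_cons[of a "foldr cancel_cons u v"] by auto
qed simp

lemma cancel_cons_mult:
  assumes "reduced w"
  shows "foldr cancel_cons (cancel_cons a v) w = cancel_cons a (foldr cancel_cons v w)"
proof (cases v)
  case (Cons b v')
  then show ?thesis
    using cancel_cons_inv[OF reduced_mult[OF assms], of a v'] by auto
qed simp

lemma mult_words_assoc:
  assumes "reduced w"
  shows "foldr cancel_cons (foldr cancel_cons u v) w = foldr cancel_cons u (foldr cancel_cons v w)"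
  using assms by (induction u) (auto simp: cancel_cons_mult)

lemma mult_words_Nil: "reduced u \<Longrightarrow> foldr cancel_cons u [] = u"
proof (induction u)
  case (Cons a u)
  then show ?case
    using reduced_tl[of a u] cancel_cons_reduced[of a u] by simp
qed simp

lemma mult_words_inverse:
  "reduced w \<Longrightarrow> foldr cancel_cons (map letter_inv (rev u)) (foldr cancel_cons u w) = w"
proof (induction u)
  case (Cons a u)
  have "cancel_cons (letter_inv a) (cancel_cons a (foldr cancel_cons u w)) = foldr cancel_cons u w"
    using cancel_cons_inv[OF reduced_mult[OF Cons.prems], of "letter_inv a" u] by simp
  then show ?case
    using Cons by simp
qed simp

lemma group_free_group: "group (free_group n)"
proof (rule groupI)
  fix x
  assume x: "x \<in> carrier (free_group n)"
  let ?y = "foldr cancel_cons (map letter_inv (rev x)) []"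
  have "set ?y \<subseteq> letter_inv ` set x"
    using set_mult_letters[of "map letter_inv (rev x)" "[]"] by auto
  then have "?y \<in> carrier (free_group n)"
    using x reduced_mult[of "[]" "map letter_inv (rev x)"] by (fastforce simp: free_group_def)
  moreover have "?y \<otimes>\<^bsub>free_group n\<^esub> x = \<one>\<^bsub>free_group n\<^esub>"
    using x mult_words_inverse[of "[]" x] mult_words_Nil[of x]
      mult_words_assoc[of x "map letter_inv (rev x)" "[]"]
    by (simp add: free_group_def)
  ultimately show "\<exists>y\<in>carrier (free_group n). y \<otimes>\<^bsub>free_group n\<^esub> x = \<one>\<^bsub>free_group n\<^esub>"
    by blast
next
  fix x y
  assume "x \<in> carrier (free_group n)" "y \<in> carrier (free_group n)"
  then show "x \<otimes>\<^bsub>free_group n\<^esub> y \<in> carrier (free_group n)"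
    using set_mult_letters[of x y] by (fastforce simp: free_group_def intro: reduced_mult)
qed (auto simp: free_group_def mult_words_assoc)

lemma free_gens_subset: "free_gens n \<subseteq> carrier (free_group n)"
  by (auto simp: free_gens_def free_group_def)


section \<open>Representations and coordinate functions\<close>

definition SL :: "nat \<Rightarrow> complex mat monoid" where
  "SL m = \<lparr>carrier = {A \<in> carrier_mat m m. det A = 1}, monoid.mult = (*), one = 1\<^sub>m m\<rparr>"

lemma group_SL: "group (SL m)"
proof (rule groupI)
  fix A
  assume "A \<in> carrier (SL m)"
  then have A: "A \<in> carrier_mat m m" and d: "det A = 1"
    by (auto simp: SL_def)
  have B: "adj_mat A \<in> carrier_mat m m" and BA: "adj_mat A * A = 1\<^sub>m m"
    using adj_mat[OF A] d by (auto intro!: eq_matI)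
  have "det (adj_mat A) = 1"
    using det_mult[OF B A] BA d by simp
  then show "\<exists>B\<in>carrier (SL m). B \<otimes>\<^bsub>SL m\<^esub> A = \<one>\<^bsub>SL m\<^esub>"
    using B BA by (intro bexI[of _ "adj_mat A"]) (simp_all add: SL_def)
qed (auto simp: SL_def det_mult)

text \<open>
  Homomorphisms are taken to be extensional, so that two of them are equal as soon as they agree
  on \<open>carrier G\<close>.
\<close>

definition reps :: "nat \<Rightarrow> ('a, 'b) monoid_scheme \<Rightarrow> ('a \<Rightarrow> complex mat) set" where
  "reps m G = hom G (SL m) \<inter> extensional (carrier G)"

definition fun_ring :: "'s set \<Rightarrow> ('s \<Rightarrow> complex) ring" where
  "fun_ring S =
    \<lparr>carrier = extensional S,
     monoid.mult = (\<lambda>f g. \<lambda>r\<in>S. f r * g r),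
     one = (\<lambda>r\<in>S. 1),
     zero = (\<lambda>r\<in>S. 0),
     add = (\<lambda>f g. \<lambda>r\<in>S. f r + g r)\<rparr>"

lemma cring_fun_ring: "cring (fun_ring S)"
proof (rule cringI)
  show "abelian_group (fun_ring S)"
  proof (rule abelian_groupI)
    fix f
    assume "f \<in> carrier (fun_ring S)"
    then show "\<exists>g\<in>carrier (fun_ring S). g \<oplus>\<^bsub>fun_ring S\<^esub> f = \<zero>\<^bsub>fun_ring S\<^esub>"
      by (intro bexI[of _ "\<lambda>r\<in>S. - f r"]) (auto simp: fun_ring_def)
  qed (auto simp: fun_ring_def extensional_def algebra_simps)
  show "comm_monoid (fun_ring S)"
    by (rule comm_monoidI) (auto simp: fun_ring_def extensional_def algebra_simps)
qed (auto simp: fun_ring_def algebra_simps)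

text \<open>Matrix indices run through \<open>0, \<dots>, m - 1\<close>.\<close>

definition coord ::
  "nat \<Rightarrow> ('a, 'b) monoid_scheme \<Rightarrow> nat \<Rightarrow> nat \<Rightarrow> 'a \<Rightarrow> ('a \<Rightarrow> complex mat) \<Rightarrow> complex" where
  "coord m G i j x = (\<lambda>r\<in>reps m G. r x $$ (i, j))"

definition rat_subalgebra :: "'s set \<Rightarrow> ('s \<Rightarrow> complex) set \<Rightarrow> bool" where
  "rat_subalgebra S V \<longleftrightarrow>
    subring V (fun_ring S) \<and> (\<forall>q::rat. \<forall>f\<in>V. (\<lambda>r\<in>S. of_rat q * f r) \<in> V)"

definition rep_ring ::
  "nat \<Rightarrow> ('a, 'b) monoid_scheme \<Rightarrow> (('a \<Rightarrow> complex mat) \<Rightarrow> complex) ring" where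
  "rep_ring m G = (fun_ring (reps m G))
    \<lparr>carrier := rat_subalgebra (reps m G) hull
       {coord m G i j x | i j x. i < m \<and> j < m \<and> x \<in> carrier G}\<rparr>"

definition s_coord ::
  "nat \<Rightarrow> ('a, 'b) monoid_scheme \<Rightarrow> nat \<Rightarrow> nat \<Rightarrow> 'a \<Rightarrow> ('a \<Rightarrow> complex mat) \<Rightarrow> complex" where
  "s_coord m G i j x = (\<lambda>r\<in>reps m G. coord m G i j x r - (if i = j then 1 else 0))"

text \<open>In the following, \<open>X\<close> is the given set of generators of \<open>G\<close>.\<close>

definition J_ideal ::
  "nat \<Rightarrow> ('a, 'b) monoid_scheme \<Rightarrow> 'a set \<Rightarrow> (('a \<Rightarrow> complex mat) \<Rightarrow> complex) set" where
  "J_ideal m G X = genideal (rep_ring m G)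
     {s_coord m G i j x | i j x. i < m \<and> j < m \<and> x \<in> X}"

definition J_power ::
  "nat \<Rightarrow> ('a, 'b) monoid_scheme \<Rightarrow> 'a set \<Rightarrow> nat \<Rightarrow> (('a \<Rightarrow> complex mat) \<Rightarrow> complex) set" where
  "J_power m G X k = J_ideal m G X [^]\<^bsub>ideals_set (rep_ring m G)\<^esub> k"


section \<open>The action of the automorphism group\<close>

text \<open>
  Writing \<open>\<sigma> x\<close> for the image of \<open>x\<close> under \<open>\<sigma>\<close>, the action on functions is precomposition of
  representations with \<open>\<sigma>\<close>.  By the lemmas below it respects the algebra operations and
  sends \<open>coord m G i j x\<close> to \<open>coord m G i j (\<sigma> x)\<close>, which determines it on \<open>rep_ring m G\<close>.
  The product of \<open>AutoGroup G\<close> is composition of maps written on the left; a right action in the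
  opposite convention has the same kernel.
\<close>

definition act ::
  "nat \<Rightarrow> ('a, 'b) monoid_scheme \<Rightarrow> ('a \<Rightarrow> 'a) \<Rightarrow> (('a \<Rightarrow> complex mat) \<Rightarrow> complex)
    \<Rightarrow> (('a \<Rightarrow> complex mat) \<Rightarrow> complex)" where
  "act m G \<sigma> f = (\<lambda>r\<in>reps m G. f (compose (carrier G) r \<sigma>))"

lemma compose_reps:
  assumes "group G" "r \<in> reps m G" "\<sigma> \<in> auto G"
  shows "compose (carrier G) r \<sigma> \<in> reps m G"
proof -
  have r: "r \<in> hom G (SL m)" and s: "\<sigma> \<in> hom G G"
    using assms by (auto simp: reps_def auto_def)
  have "compose (carrier G) r \<sigma> \<in> hom G (SL m)"
    using r s by (simp add: hom_def compose_def Pi_iff monoid.m_closed[OF group.is_monoid[OF assms(1)]])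
  then show ?thesis
    by (simp add: reps_def)
qed

lemma act_coord:
  assumes "group G" "\<sigma> \<in> auto G" "x \<in> carrier G"
  shows "act m G \<sigma> (coord m G i j x) = coord m G i j (\<sigma> x)"
proof
  fix r
  show "act m G \<sigma> (coord m G i j x) r = coord m G i j (\<sigma> x) r"
    using assms compose_reps[OF assms(1) _ assms(2), of r m]
    by (simp add: act_def coord_def restrict_def compose_eq)
qed

lemma act_one: "group G \<Longrightarrow> \<sigma> \<in> auto G \<Longrightarrow> act m G \<sigma> \<one>\<^bsub>rep_ring m G\<^esub> = \<one>\<^bsub>rep_ring m G\<^esub>"
  by (rule ext) (simp add: act_def rep_ring_def fun_ring_def compose_reps restrict_def)

lemma act_mult:
  "group G \<Longrightarrow> \<sigma> \<in> auto G \<Longrightarrow>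
    act m G \<sigma> (f \<otimes>\<^bsub>rep_ring m G\<^esub> g) = act m G \<sigma> f \<otimes>\<^bsub>rep_ring m G\<^esub> act m G \<sigma> g"
  by (rule ext) (simp add: act_def rep_ring_def fun_ring_def compose_reps restrict_def)

lemma act_add:
  "group G \<Longrightarrow> \<sigma> \<in> auto G \<Longrightarrow>
    act m G \<sigma> (f \<oplus>\<^bsub>rep_ring m G\<^esub> g) = act m G \<sigma> f \<oplus>\<^bsub>rep_ring m G\<^esub> act m G \<sigma> g"
  by (rule ext) (simp add: act_def rep_ring_def fun_ring_def compose_reps restrict_def)

text \<open>
  The additive group underlying the quotient of \<open>J_ideal m G X\<close> by \<open>J_power m G X (k + 1)\<close>.
\<close>

definition J_quotient ::
  "nat \<Rightarrow> ('a, 'b) monoid_scheme \<Rightarrow> 'a set \<Rightarrow> nat \<Rightarrow>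
    (('a \<Rightarrow> complex mat) \<Rightarrow> complex) set monoid" where
  "J_quotient m G X k =
    (add_monoid (rep_ring m G))\<lparr>carrier := J_ideal m G X\<rparr> Mod J_power m G X (k + 1)"

definition D_filt ::
  "nat \<Rightarrow> ('a, 'b) monoid_scheme \<Rightarrow> 'a set \<Rightarrow> nat \<Rightarrow> ('a \<Rightarrow> 'a) set" where
  "D_filt m G X k = kernel (AutoGroup G) (AutoGroup (J_quotient m G X k))
     (\<lambda>\<sigma>. \<lambda>C\<in>carrier (J_quotient m G X k). act m G \<sigma> ` C)"


section \<open>The lower central series and the Andreadakis-Johnson filtration\<close>

definition commutator_subgroup ::
  "('a, 'b) monoid_scheme \<Rightarrow> 'a set \<Rightarrow> 'a set \<Rightarrow> 'a set" where
  "commutator_subgroup G H K =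
    generate G {h \<otimes>\<^bsub>G\<^esub> k \<otimes>\<^bsub>G\<^esub> inv\<^bsub>G\<^esub> h \<otimes>\<^bsub>G\<^esub> inv\<^bsub>G\<^esub> k | h k. h \<in> H \<and> k \<in> K}"

text \<open>The series starts with index \<open>1\<close>; the value at \<open>0\<close> is a dummy.\<close>

fun lower_central :: "('a, 'b) monoid_scheme \<Rightarrow> nat \<Rightarrow> 'a set" where
  "lower_central G 0 = carrier G"
| "lower_central G (Suc 0) = carrier G"
| "lower_central G (Suc (Suc k)) =
    commutator_subgroup G (lower_central G (Suc k)) (carrier G)"

definition A_filt :: "('a, 'b) monoid_scheme \<Rightarrow> nat \<Rightarrow> ('a \<Rightarrow> 'a) set" where
  "A_filt G k = kernel (AutoGroup G) (AutoGroup (G Mod lower_central G (k + 1)))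
     (\<lambda>\<sigma>. \<lambda>C\<in>carrier (G Mod lower_central G (k + 1)). \<sigma> ` C)"

end

theory Submission
  imports Defs
begin

text \<open>
  Both inclusions are proved for an arbitrary group \<open>G\<close> with generating set \<open>X\<close>.
  Write \<open>J\<close> for the ideal and \<open>a(x)\<close> for the matrix of coordinate functions of
  \<open>x\<close>, so that \<open>a(xy) = a(x) a(y)\<close>.

  Triviality of \<open>\<sigma>\<close> on \<open>J / J\<^sup>k\<^sup>+\<^sup>1\<close> means that
  \<open>f\<^sup>\<sigma> - f\<close> lies in \<open>J\<^sup>k\<^sup>+\<^sup>1\<close> for all
  \<open>f\<close> in \<open>J\<close> (\<open>mem_D_filt_iff\<close>); passing from this condition to
  equality of cosets uses that every automorphism maps each power of \<open>J\<close> onto itself.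

  For the first inclusion, compare group elements modulo an ideal \<open>I\<close>: \<open>x\<close> and
  \<open>y\<close> are congruent if all entries of \<open>a(x) - a(y)\<close> lie in \<open>I\<close>. This
  relation is stable under right translation, because \<open>a(xz) - a(yz) = (a(x) - a(y)) a(z)\<close>. The
  identity \<open>hg - gh = (h - 1)(g - 1) - (g - 1)(h - 1)\<close> shows that the commutator of an element
  congruent to \<open>1\<close> modulo \<open>I\<close> with one congruent to \<open>1\<close> modulo
  \<open>I'\<close> is congruent to \<open>1\<close> modulo \<open>I I'\<close>, and by induction every
  element of the \<open>k\<close>-th term of the lower central series is congruent to \<open>1\<close> modulo
  \<open>J\<^sup>k\<close> (\<open>coord_cong_lower_central\<close>). If \<open>\<sigma>\<close> acts
  trivially modulo the \<open>(k+1)\<close>-st term, then \<open>\<sigma>(x) = c x\<close> with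
  \<open>c\<close> in that term, so \<open>\<sigma>(x)\<close> is congruent to \<open>x\<close> modulo
  \<open>J\<^sup>k\<^sup>+\<^sup>1\<close>. Thus \<open>\<sigma>\<close> moves each algebra generator, and
  hence each function in the algebra, by an element of \<open>J\<^sup>k\<^sup>+\<^sup>1\<close>
  (\<open>act_cong_on_rep_ring\<close>).

  For the second inclusion, the block embedding of \<open>SL(m)\<close> into \<open>SL(m+1)\<close> turns
  representations of degree \<open>m\<close> into representations of degree \<open>m+1\<close>. Restriction of
  functions along this map is a ring homomorphism that commutes with the action of \<open>\<sigma>\<close> and
  maps the ideal of degree \<open>m+1\<close> onto the ideal of degree \<open>m\<close>
  (\<open>stabilise_pullback_J_ideal\<close>), hence powers into powers. Lifting \<open>f\<close> to degree
  \<open>m+1\<close>, applying the hypothesis on \<open>\<sigma>\<close> there and restricting again gives the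
  claim.
\<close>


section \<open>The rational algebra of coordinate functions\<close>

lemma rat_subalgebra_carrier: "rat_subalgebra S (carrier (fun_ring S))"
proof -
  interpret F: cring "fun_ring S" by (rule cring_fun_ring)
  show ?thesis
    using F.carrier_is_subring by (auto simp: rat_subalgebra_def fun_ring_def)
qed

lemma rat_subalgebra_hull:
  assumes "A \<subseteq> extensional S"
  shows "rat_subalgebra S (rat_subalgebra S hull A)"
proof -
  interpret F: cring "fun_ring S" by (rule cring_fun_ring)
  let ?T = "{V. rat_subalgebra S V \<and> A \<subseteq> V}"
  have "?T \<noteq> {}"
    using rat_subalgebra_carrier[of S] assms by (auto simp: fun_ring_def)
  then have "subring (\<Inter>?T) (fun_ring S)"
    by (intro F.subring_Inter) (auto simp: rat_subalgebra_def)
  then show ?thesis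
    unfolding rat_subalgebra_def[of S "\<Inter>?T"] hull_def by (auto simp: rat_subalgebra_def)
qed

lemma rat_subalgebraI:
  assumes "V \<subseteq> extensional S"
    and "(\<lambda>r\<in>S. 1) \<in> V"
    and "\<And>f g. f \<in> V \<Longrightarrow> g \<in> V \<Longrightarrow> (\<lambda>r\<in>S. f r + g r) \<in> V"
    and "\<And>f g. f \<in> V \<Longrightarrow> g \<in> V \<Longrightarrow> (\<lambda>r\<in>S. f r * g r) \<in> V"
    and scale: "\<And>q::rat. \<And>f. f \<in> V \<Longrightarrow> (\<lambda>r\<in>S. of_rat q * f r) \<in> V"
  shows "rat_subalgebra S V"
proof -
  interpret F: cring "fun_ring S" by (rule cring_fun_ring)
  have "\<ominus>\<^bsub>fun_ring S\<^esub> f \<in> V" if "f \<in> V" for f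
  proof -
    have "f \<in> extensional S"
      using that assms(1) by auto
    then have "\<ominus>\<^bsub>fun_ring S\<^esub> f = (\<lambda>r\<in>S. - f r)"
      by (intro F.minus_equality) (auto simp: fun_ring_def)
    then show ?thesis
      using scale[OF that, of "-1"] by simp
  qed
  then have "subring V (fun_ring S)"
    using assms by (intro F.subringI) (auto simp: fun_ring_def)
  with scale show ?thesis
    by (auto simp: rat_subalgebra_def)
qed

lemma rat_subalgebraD:
  assumes "rat_subalgebra S V"
  shows "V \<subseteq> extensional S"
    and "(\<lambda>r\<in>S. 1) \<in> V"
    and "\<And>f g. f \<in> V \<Longrightarrow> g \<in> V \<Longrightarrow> (\<lambda>r\<in>S. f r + g r) \<in> V"
    and "\<And>f g. f \<in> V \<Longrightarrow> g \<in> V \<Longrightarrow> (\<lambda>r\<in>S. f r * g r) \<in> V"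
    and "\<And>q::rat. \<And>f. f \<in> V \<Longrightarrow> (\<lambda>r\<in>S. of_rat q * f r) \<in> V"
  using assms subringE[of V "fun_ring S"] by (auto simp: rat_subalgebra_def fun_ring_def)

lemma rep_ring_simps:
  "f \<otimes>\<^bsub>rep_ring m G\<^esub> g = (\<lambda>r\<in>reps m G. f r * g r)"
  "f \<oplus>\<^bsub>rep_ring m G\<^esub> g = (\<lambda>r\<in>reps m G. f r + g r)"
  "\<one>\<^bsub>rep_ring m G\<^esub> = (\<lambda>r\<in>reps m G. 1)"
  "\<zero>\<^bsub>rep_ring m G\<^esub> = (\<lambda>r\<in>reps m G. 0)"
  by (simp_all add: rep_ring_def fun_ring_def)

lemma rat_subalgebra_rep_ring: "rat_subalgebra (reps m G) (carrier (rep_ring m G))"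
proof -
  have "{coord m G i j x | i j x. i < m \<and> j < m \<and> x \<in> carrier G} \<subseteq> extensional (reps m G)"
    by (auto simp: coord_def)
  from rat_subalgebra_hull[OF this] show ?thesis
    by (simp add: rep_ring_def)
qed

lemmas rep_ring_closed = rat_subalgebraD[OF rat_subalgebra_rep_ring]

lemma cring_rep_ring: "cring (rep_ring m G)"
proof -
  interpret F: cring "fun_ring (reps m G)" by (rule cring_fun_ring)
  have s: "subring (carrier (rep_ring m G)) (fun_ring (reps m G))"
    using rat_subalgebra_rep_ring by (auto simp: rat_subalgebra_def)
  show ?thesis
    using F.subcring_iff[OF subringE(1)[OF s]] F.subcringI'[OF s] by (simp add: rep_ring_def)
qed

lemma ring_rep_ring: "ring (rep_ring m G)"
  using cring_rep_ring by (rule cring.axioms)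

lemma coord_in_rep_ring:
  "i < m \<Longrightarrow> j < m \<Longrightarrow> x \<in> carrier G \<Longrightarrow> coord m G i j x \<in> carrier (rep_ring m G)"
  by (auto simp: rep_ring_def intro!: hull_inc)

lemma rep_ring_minimal:
  assumes "rat_subalgebra (reps m G) V"
    and "\<And>i j x. i < m \<Longrightarrow> j < m \<Longrightarrow> x \<in> carrier G \<Longrightarrow> coord m G i j x \<in> V"
  shows "carrier (rep_ring m G) \<subseteq> V"
proof -
  have "{coord m G i j x | i j x. i < m \<and> j < m \<and> x \<in> carrier G} \<subseteq> V"
    using assms(2) by auto
  from hull_minimal[where S = "rat_subalgebra (reps m G)", OF this assms(1)] show ?thesis
    by (simp add: rep_ring_def)
qed

lemma rep_ring_const:
  "(\<lambda>r\<in>reps m G. of_rat q) \<in> carrier (rep_ring m G)"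
  using rep_ring_closed(5)[OF rep_ring_closed(2), of q m G] by (simp add: restrict_def if_distrib cong: if_cong)

text \<open>
  The ring operations written pointwise: functions that are given by formulas in the entries of
  the matrices can then be treated by extensionality.
\<close>

lemma ideal_closed:
  assumes "ideal I (rep_ring m G)"
  shows "I \<subseteq> carrier (rep_ring m G)"
    and "(\<lambda>r\<in>reps m G. 0) \<in> I"
    and "f \<in> I \<Longrightarrow> g \<in> I \<Longrightarrow> (\<lambda>r\<in>reps m G. f r + g r) \<in> I"
    and "f \<in> I \<Longrightarrow> h \<in> carrier (rep_ring m G) \<Longrightarrow> (\<lambda>r\<in>reps m G. f r * h r) \<in> I"
    and "f \<in> I \<Longrightarrow> (\<lambda>r\<in>reps m G. of_rat q * f r) \<in> I"
    and "f \<in> I \<Longrightarrow> g \<in> I \<Longrightarrow> (\<lambda>r\<in>reps m G. f r - g r) \<in> I"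
proof -
  interpret ideal I "rep_ring m G" by fact
  show "I \<subseteq> carrier (rep_ring m G)"
    using Icarr by auto
  show "(\<lambda>r\<in>reps m G. 0) \<in> I"
    using additive_subgroup.zero_closed[OF is_additive_subgroup] by (simp add: rep_ring_simps)
  show add: "(\<lambda>r\<in>reps m G. f r + g r) \<in> I" if "f \<in> I" "g \<in> I" for f g
    using additive_subgroup.a_closed[OF is_additive_subgroup that] by (simp add: rep_ring_simps)
  show "(\<lambda>r\<in>reps m G. f r * h r) \<in> I" if "f \<in> I" "h \<in> carrier (rep_ring m G)" for f h
    using I_r_closed[OF that] by (simp add: rep_ring_simps)
  show scale: "(\<lambda>r\<in>reps m G. of_rat q * f r) \<in> I" if "f \<in> I" for f q
  proof -
    have "(\<lambda>r\<in>reps m G. of_rat q * f r)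
        = (\<lambda>r\<in>reps m G. of_rat q) \<otimes>\<^bsub>rep_ring m G\<^esub> f"
      by (auto simp: rep_ring_simps)
    then show ?thesis
      using I_l_closed[OF that rep_ring_const] by simp
  qed
  show "(\<lambda>r\<in>reps m G. f r - g r) \<in> I" if "f \<in> I" "g \<in> I"
  proof -
    have "(\<lambda>r\<in>reps m G. f r - g r)
        = (\<lambda>r\<in>reps m G. f r + (\<lambda>r\<in>reps m G. of_rat (-1) * g r) r)"
      by auto
    then show ?thesis
      using add[OF that(1) scale[OF that(2), of "-1"]] by simp
  qed
qed

lemma ideal_sum:
  assumes "ideal I (rep_ring m G)" and "\<And>u. u < (p::nat) \<Longrightarrow> (\<lambda>r\<in>reps m G. F u r) \<in> I"
  shows "(\<lambda>r\<in>reps m G. \<Sum>u<p. F u r) \<in> I"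
  using assms(2)
proof (induction p)
  case 0
  then show ?case
    using ideal_closed(2)[OF assms(1)] by (simp only: lessThan_0 sum.empty)
next
  case (Suc p)
  have "(\<lambda>r\<in>reps m G. \<Sum>u<Suc p. F u r)
      = (\<lambda>r\<in>reps m G. (\<lambda>r\<in>reps m G. \<Sum>u<p. F u r) r + (\<lambda>r\<in>reps m G. F p r) r)"
    by auto
  moreover have "(\<lambda>r\<in>reps m G. \<Sum>u<p. F u r) \<in> I" "(\<lambda>r\<in>reps m G. F p r) \<in> I"
    by ((rule Suc.IH, rule Suc.prems, simp), (rule Suc.prems, simp))
  ultimately show ?case
    using ideal_closed(3)[OF assms(1)] by (simp only:)
qed


section \<open>Congruence of group elements modulo an ideal\<close>

text \<open>
  The difference is evaluated on representations directly, which makes congruence to the unit the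
  condition that all functions \<open>s_coord m G i j x\<close> lie in \<open>I\<close>.
\<close>

definition coord_cong ::
  "nat \<Rightarrow> ('a, 'b) monoid_scheme \<Rightarrow> (('a \<Rightarrow> complex mat) \<Rightarrow> complex) set \<Rightarrow> 'a \<Rightarrow> 'a \<Rightarrow> bool" where
  "coord_cong m G I x y \<longleftrightarrow>
    (\<forall>i<m. \<forall>j<m. (\<lambda>r\<in>reps m G. r x $$ (i, j) - r y $$ (i, j)) \<in> I)"

lemma rep_carrier:
  assumes "r \<in> reps m G" "x \<in> carrier G"
  shows "r x \<in> carrier_mat m m"
  using assms by (auto simp: reps_def hom_def SL_def Pi_iff)

lemma rep_mult:
  assumes "r \<in> reps m G" "x \<in> carrier G" "y \<in> carrier G" "i < m" "j < m"
  shows "r (x \<otimes>\<^bsub>G\<^esub> y) $$ (i, j) = (\<Sum>u<m. r x $$ (i, u) * r y $$ (u, j))"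
proof -
  have "r (x \<otimes>\<^bsub>G\<^esub> y) = r x * r y"
    using assms by (auto simp: reps_def hom_def SL_def)
  then show ?thesis
    using assms rep_carrier[OF assms(1,2)] rep_carrier[OF assms(1,3)]
    by (simp add: scalar_prod_def atLeast0LessThan)
qed

lemma rep_one:
  assumes "group G" "r \<in> reps m G"
  shows "r \<one>\<^bsub>G\<^esub> = 1\<^sub>m m"
  using hom_one[OF _ assms(1) group_SL, of r m] assms by (auto simp: reps_def SL_def)

lemma coord_cong_sym:
  assumes "ideal I (rep_ring m G)" "coord_cong m G I x y"
  shows "coord_cong m G I y x"
  unfolding coord_cong_def
proof (intro allI impI)
  fix i j
  assume "i < m" "j < m"
  then have "(\<lambda>r\<in>reps m G. r x $$ (i, j) - r y $$ (i, j)) \<in> I" (is "?f \<in> I")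
    using assms(2) by (simp add: coord_cong_def)
  from ideal_closed(5)[OF assms(1) this, of "-1"]
  have "(\<lambda>r\<in>reps m G. of_rat (-1) * ?f r) \<in> I" .
  moreover have "(\<lambda>r\<in>reps m G. of_rat (-1) * ?f r)
      = (\<lambda>r\<in>reps m G. r y $$ (i, j) - r x $$ (i, j))"
    by auto
  ultimately show "(\<lambda>r\<in>reps m G. r y $$ (i, j) - r x $$ (i, j)) \<in> I" by (simp only:)
qed

lemma coord_cong_trans:
  assumes "ideal I (rep_ring m G)" "coord_cong m G I x y" "coord_cong m G I y z"
  shows "coord_cong m G I x z"
  unfolding coord_cong_def
proof (intro allI impI)
  fix i j
  assume "i < m" "j < m"
  then have "(\<lambda>r\<in>reps m G. r x $$ (i, j) - r y $$ (i, j)) \<in> I" (is "?f \<in> I")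
    and "(\<lambda>r\<in>reps m G. r y $$ (i, j) - r z $$ (i, j)) \<in> I" (is "?g \<in> I")
    using assms(2,3) by (simp_all add: coord_cong_def)
  from ideal_closed(3)[OF assms(1) this]
  have "(\<lambda>r\<in>reps m G. ?f r + ?g r) \<in> I" .
  moreover have "(\<lambda>r\<in>reps m G. ?f r + ?g r) = (\<lambda>r\<in>reps m G. r x $$ (i, j) - r z $$ (i, j))"
    by auto
  ultimately show "(\<lambda>r\<in>reps m G. r x $$ (i, j) - r z $$ (i, j)) \<in> I" by (simp only:)
qed

text \<open>
  The entries of \<open>a(xz) - a(yz) = (a(x) - a(y)) a(z)\<close> are combinations of the entries of
  \<open>a(x) - a(y)\<close> with coefficients in the ring.
\<close>

lemma coord_cong_mult_right:
  assumes "ideal I (rep_ring m G)" "coord_cong m G I x y"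
    and "x \<in> carrier G" "y \<in> carrier G" "z \<in> carrier G"
  shows "coord_cong m G I (x \<otimes>\<^bsub>G\<^esub> z) (y \<otimes>\<^bsub>G\<^esub> z)"
  unfolding coord_cong_def
proof (intro allI impI)
  fix i j
  assume ij: "i < m" "j < m"
  have "(\<lambda>r\<in>reps m G. (r x $$ (i, u) - r y $$ (i, u)) * r z $$ (u, j)) \<in> I" if "u < m" for u
  proof -
    have "(\<lambda>r\<in>reps m G. r x $$ (i, u) - r y $$ (i, u)) \<in> I" (is "?f \<in> I")
      using ij that assms(2) by (simp add: coord_cong_def)
    then have "(\<lambda>r\<in>reps m G. ?f r * coord m G u j z r) \<in> I"
      using ij that assms by (intro ideal_closed(4) coord_in_rep_ring)
    moreover have "(\<lambda>r\<in>reps m G. ?f r * coord m G u j z r)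
        = (\<lambda>r\<in>reps m G. (r x $$ (i, u) - r y $$ (i, u)) * r z $$ (u, j))"
      by (auto simp: coord_def)
    ultimately show ?thesis by (simp only:)
  qed
  from ideal_sum[OF assms(1) this]
  have "(\<lambda>r\<in>reps m G. \<Sum>u<m. (r x $$ (i, u) - r y $$ (i, u)) * r z $$ (u, j)) \<in> I" .
  moreover have "(\<lambda>r\<in>reps m G. \<Sum>u<m. (r x $$ (i, u) - r y $$ (i, u)) * r z $$ (u, j))
      = (\<lambda>r\<in>reps m G. r (x \<otimes>\<^bsub>G\<^esub> z) $$ (i, j) - r (y \<otimes>\<^bsub>G\<^esub> z) $$ (i, j))"
    using ij assms by (auto simp: rep_mult sum_subtractf left_diff_distrib)
  ultimately show "(\<lambda>r\<in>reps m G. r (x \<otimes>\<^bsub>G\<^esub> z) $$ (i, j) - r (y \<otimes>\<^bsub>G\<^esub> z) $$ (i, j)) \<in> I"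
    by (simp only:)
qed

text \<open>
  Right translation suffices: from \<open>x = 1\<close> it gives \<open>xy = y\<close> and, on multiplying by the inverse of
  \<open>x\<close>, also that this inverse is congruent to \<open>1\<close>.
\<close>

lemma coord_cong_one_subgroup:
  assumes "group G" "ideal I (rep_ring m G)"
  shows "subgroup {x \<in> carrier G. coord_cong m G I x \<one>\<^bsub>G\<^esub>} G"
proof -
  interpret group G by fact
  note tr = coord_cong_trans[OF assms(2)] and mr = coord_cong_mult_right[OF assms(2)]
  show ?thesis
  proof (rule subgroupI)
    have "coord_cong m G I \<one>\<^bsub>G\<^esub> \<one>\<^bsub>G\<^esub>"
      using ideal_closed(2)[OF assms(2)] by (simp add: coord_cong_def)
    then show "{x \<in> carrier G. coord_cong m G I x \<one>\<^bsub>G\<^esub>} \<noteq> {}"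
      by blast
  next
    fix x
    assume x: "x \<in> {x \<in> carrier G. coord_cong m G I x \<one>\<^bsub>G\<^esub>}"
    then have "coord_cong m G I (x \<otimes>\<^bsub>G\<^esub> inv\<^bsub>G\<^esub> x) (\<one>\<^bsub>G\<^esub> \<otimes>\<^bsub>G\<^esub> inv\<^bsub>G\<^esub> x)"
      by (intro mr) auto
    then show "inv\<^bsub>G\<^esub> x \<in> {x \<in> carrier G. coord_cong m G I x \<one>\<^bsub>G\<^esub>}"
      using x coord_cong_sym[OF assms(2)] by simp
  next
    fix x y
    assume x: "x \<in> {x \<in> carrier G. coord_cong m G I x \<one>\<^bsub>G\<^esub>}"
      and y: "y \<in> {x \<in> carrier G. coord_cong m G I x \<one>\<^bsub>G\<^esub>}"
    then have "coord_cong m G I (x \<otimes>\<^bsub>G\<^esub> y) (\<one>\<^bsub>G\<^esub> \<otimes>\<^bsub>G\<^esub> y)"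
      by (intro mr) auto
    then show "x \<otimes>\<^bsub>G\<^esub> y \<in> {x \<in> carrier G. coord_cong m G I x \<one>\<^bsub>G\<^esub>}"
      using x y tr by auto
  qed auto
qed

lemma s_coord_altdef:
  assumes "group G" "i < m" "j < m"
  shows "s_coord m G i j x = (\<lambda>r\<in>reps m G. r x $$ (i, j) - r \<one>\<^bsub>G\<^esub> $$ (i, j))"
  using assms by (auto simp: s_coord_def coord_def rep_one)

lemma s_coord_in_rep_ring:
  assumes "group G" "i < m" "j < m" "x \<in> carrier G"
  shows "s_coord m G i j x \<in> carrier (rep_ring m G)"
proof -
  interpret group G by fact
  have "(\<lambda>r\<in>reps m G. coord m G i j x r - coord m G i j \<one>\<^bsub>G\<^esub> r) \<in> carrier (rep_ring m G)"
    using assms ring.oneideal[OF ring_rep_ring]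
    by (intro ideal_closed(6) coord_in_rep_ring) auto
  moreover have "(\<lambda>r\<in>reps m G. coord m G i j x r - coord m G i j \<one>\<^bsub>G\<^esub> r) = s_coord m G i j x"
    using assms by (auto simp: s_coord_altdef coord_def)
  ultimately show ?thesis by (simp only:)
qed

text \<open>
  Because the matrix identity \<open>hg - gh = (h - 1)(g - 1) - (g - 1)(h - 1)\<close> has entries in
  \<open>IJ\<close>: each summand is a product of an entry of \<open>h - 1\<close>, in \<open>I\<close>, and an entry of \<open>g - 1\<close>, in \<open>J\<close>.
\<close>

lemma coord_cong_commute:
  assumes "group G" and I: "ideal I (rep_ring m G)" and J: "ideal J (rep_ring m G)"
    and h: "h \<in> carrier G" "coord_cong m G I h \<one>\<^bsub>G\<^esub>"
    and g: "g \<in> carrier G" "coord_cong m G J g \<one>\<^bsub>G\<^esub>"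
  shows "coord_cong m G (I \<cdot>\<^bsub>rep_ring m G\<^esub> J) (h \<otimes>\<^bsub>G\<^esub> g) (g \<otimes>\<^bsub>G\<^esub> h)"
  unfolding coord_cong_def
proof (intro allI impI)
  fix i j
  assume ij: "i < m" "j < m"
  interpret group G by fact
  let ?R = "rep_ring m G"
  let ?s = "s_coord m G"
  have IJ: "ideal (I \<cdot>\<^bsub>?R\<^esub> J) ?R"
    using ring.ideal_prod_is_ideal[OF ring_rep_ring I J] .
  have sI: "?s u v h \<in> I" and sJ: "?s u v g \<in> J" if "u < m" "v < m" for u v
    using h g that assms(1) by (auto simp: s_coord_altdef coord_cong_def)
  \<comment> \<open>In the second product the factor from \<open>h\<close> is written first, so that both products are visibly
    in \<open>IJ\<close>; the entries commute.\<close>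
  have "(\<lambda>r\<in>reps m G. ?s i u h r * ?s u j g r - ?s u j h r * ?s i u g r) \<in> I \<cdot>\<^bsub>?R\<^esub> J"
    if "u < m" for u
  proof -
    have "?s i u h \<otimes>\<^bsub>?R\<^esub> ?s u j g \<in> I \<cdot>\<^bsub>?R\<^esub> J" "?s u j h \<otimes>\<^bsub>?R\<^esub> ?s i u g \<in> I \<cdot>\<^bsub>?R\<^esub> J"
      using ij that sI sJ by (auto intro: ideal_prod.prod)
    from ideal_closed(6)[OF IJ this] show ?thesis
      by (simp add: rep_ring_simps restrict_def cong: if_cong)
  qed
  from ideal_sum[OF IJ this]
  have "(\<lambda>r\<in>reps m G. \<Sum>u<m. ?s i u h r * ?s u j g r - ?s u j h r * ?s i u g r) \<in> I \<cdot>\<^bsub>?R\<^esub> J" .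
  moreover have "(\<Sum>u<m. ?s i u h r * ?s u j g r - ?s u j h r * ?s i u g r)
      = r (h \<otimes>\<^bsub>G\<^esub> g) $$ (i, j) - r (g \<otimes>\<^bsub>G\<^esub> h) $$ (i, j)" if r: "r \<in> reps m G" for r
  proof -
    let ?d = "\<lambda>a b. if a = b then 1 else 0 :: complex"
    have expand: "(\<Sum>u<m. (a u - ?d i u) * (b u - ?d u j))
        = (\<Sum>u<m. a u * b u) - a j - b i + ?d i j" for a b :: "nat \<Rightarrow> complex"
    proof -
      have "(\<Sum>u<m. (a u - ?d i u) * (b u - ?d u j))
          = (\<Sum>u<m. a u * b u - (if u = j then a u else 0) - (if i = u then b u else 0)
              + (if i = u then ?d u j else 0))"
        by (intro sum.cong) (auto simp: algebra_simps)
      also have "\<dots> = (\<Sum>u<m. a u * b u) - a j - b i + ?d i j"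
        using ij by (simp add: sum.distrib sum_subtractf)
      finally show ?thesis .
    qed
    have "(\<Sum>u<m. ?s i u h r * ?s u j g r - ?s u j h r * ?s i u g r)
        = (\<Sum>u<m. (r h $$ (i, u) - ?d i u) * (r g $$ (u, j) - ?d u j))
          - (\<Sum>u<m. (r g $$ (i, u) - ?d i u) * (r h $$ (u, j) - ?d u j))"
      using r by (simp add: s_coord_def coord_def sum_subtractf mult.commute)
    also have "\<dots> = r (h \<otimes>\<^bsub>G\<^esub> g) $$ (i, j) - r (g \<otimes>\<^bsub>G\<^esub> h) $$ (i, j)"
      using r ij h g by (simp add: expand rep_mult)
    finally show ?thesis .
  qed
  ultimately show "(\<lambda>r\<in>reps m G. r (h \<otimes>\<^bsub>G\<^esub> g) $$ (i, j) - r (g \<otimes>\<^bsub>G\<^esub> h) $$ (i, j)) \<in> I \<cdot>\<^bsub>?R\<^esub> J"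
    by (simp cong: restrict_cong)
qed


section \<open>Powers of the ideal and the lower central series\<close>

lemma ideal_J_ideal:
  assumes "group G" "X \<subseteq> carrier G"
  shows "ideal (J_ideal m G X) (rep_ring m G)"
  unfolding J_ideal_def using assms
  by (intro ring.genideal_ideal ring_rep_ring) (auto intro: s_coord_in_rep_ring)

lemma J_power_0: "J_power m G X 0 = carrier (rep_ring m G)"
  by (simp add: J_power_def nat_pow_def ideals_set_def)

lemma J_power_Suc:
  "J_power m G X (Suc k) = J_power m G X k \<cdot>\<^bsub>rep_ring m G\<^esub> J_ideal m G X"
  by (simp add: J_power_def nat_pow_def ideals_set_def)

lemma ideal_J_power:
  assumes "group G" "X \<subseteq> carrier G"
  shows "ideal (J_power m G X k) (rep_ring m G)"
proof (induction k)
  case 0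
  show ?case
    using ring.oneideal[OF ring_rep_ring] by (simp add: J_power_0)
next
  case (Suc k)
  then show ?case
    unfolding J_power_Suc
    by (rule ring.ideal_prod_is_ideal[OF ring_rep_ring _ ideal_J_ideal[OF assms]])
qed

lemma J_power_1:
  assumes "group G" "X \<subseteq> carrier G"
  shows "J_power m G X (Suc 0) = J_ideal m G X"
proof -
  interpret R: cring "rep_ring m G" by (rule cring_rep_ring)
  show ?thesis
    using R.ideal_prod_commute[OF R.oneideal ideal_J_ideal[OF assms]]
      R.ideal_prod_one[OF ideal_J_ideal[OF assms]]
    by (simp add: J_power_Suc J_power_0)
qed

text \<open>
  The ideal is generated by the functions that belong to \<open>X\<close>, but it contains those of all group
  elements: the elements congruent to \<open>1\<close> form a subgroup containing \<open>X\<close>.  This makes the ideal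
  independent of the choice of generators and so invariant under automorphisms.
\<close>

lemma coord_cong_J_ideal:
  assumes "group G" "X \<subseteq> carrier G" "generate G X = carrier G" "x \<in> carrier G"
  shows "coord_cong m G (J_ideal m G X) x \<one>\<^bsub>G\<^esub>"
proof -
  have "X \<subseteq> {x \<in> carrier G. coord_cong m G (J_ideal m G X) x \<one>\<^bsub>G\<^esub>}"
  proof
    fix x
    assume x: "x \<in> X"
    have "s_coord m G i j x \<in> J_ideal m G X" if "i < m" "j < m" for i j
      using x that by (auto simp: J_ideal_def genideal_def)
    then show "x \<in> {x \<in> carrier G. coord_cong m G (J_ideal m G X) x \<one>\<^bsub>G\<^esub>}"
      using x assms by (auto simp: coord_cong_def s_coord_altdef)
  qed
  with coord_cong_one_subgroup[OF assms(1) ideal_J_ideal[OF assms(1,2)]]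
  have "generate G X \<subseteq> {x \<in> carrier G. coord_cong m G (J_ideal m G X) x \<one>\<^bsub>G\<^esub>}"
    by (intro group.generate_subgroup_incl[OF assms(1)])
  then show ?thesis
    using assms by auto
qed

lemma lower_central_subset:
  assumes "group G"
  shows "lower_central G (Suc k) \<subseteq> carrier G"
proof (induction k)
  case (Suc k)
  interpret group G by fact
  show ?case
    unfolding lower_central.simps commutator_subgroup_def
    using Suc by (intro generate_incl) auto
qed simp

lemma one_in_lower_central:
  assumes "group G"
  shows "\<one>\<^bsub>G\<^esub> \<in> lower_central G (Suc k)"
  using assms by (cases k) (auto simp: commutator_subgroup_def generate.one group.is_monoid monoid.one_closed)

text \<open>
  In the inductive step \<open>h\<close> is congruent to \<open>1\<close> modulo \<open>J\<^sup>k\<close> and \<open>g\<close> modulo \<open>J\<close>, so \<open>hg\<close> and \<open>gh\<close> are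
  congruent modulo \<open>J\<^sup>k\<^sup>+\<^sup>1\<close>; translating by the inverse of \<open>gh\<close> turns this into a statement
  about the commutator.
\<close>

lemma coord_cong_lower_central:
  assumes "group G" "X \<subseteq> carrier G" "generate G X = carrier G"
  shows "x \<in> lower_central G (Suc k) \<Longrightarrow> coord_cong m G (J_power m G X (Suc k)) x \<one>\<^bsub>G\<^esub>"
proof (induction k arbitrary: x)
  case 0
  then show ?case
    using coord_cong_J_ideal[OF assms] by (simp add: J_power_1[OF assms(1,2)])
next
  case (Suc k)
  interpret group G by fact
  let ?I = "J_power m G X (Suc (Suc k))"
  have I: "ideal ?I (rep_ring m G)"
    using ideal_J_power[OF assms(1,2)] .
  let ?H = "{x \<in> carrier G. coord_cong m G ?I x \<one>\<^bsub>G\<^esub>}"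
  have "h \<otimes>\<^bsub>G\<^esub> g \<otimes>\<^bsub>G\<^esub> inv\<^bsub>G\<^esub> h \<otimes>\<^bsub>G\<^esub> inv\<^bsub>G\<^esub> g \<in> ?H"
    if h: "h \<in> lower_central G (Suc k)" and g: "g \<in> carrier G" for h g
  proof -
    have hG: "h \<in> carrier G"
      using h lower_central_subset[OF assms(1)] by blast
    have "coord_cong m G ?I (h \<otimes>\<^bsub>G\<^esub> g) (g \<otimes>\<^bsub>G\<^esub> h)"
      unfolding J_power_Suc[of m G X "Suc k"]
      using h g hG
      by (intro coord_cong_commute ideal_J_power ideal_J_ideal coord_cong_J_ideal Suc.IH assms)
    from coord_cong_mult_right[OF I this, of "inv\<^bsub>G\<^esub> h \<otimes>\<^bsub>G\<^esub> inv\<^bsub>G\<^esub> g"]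
    have "coord_cong m G ?I (h \<otimes>\<^bsub>G\<^esub> g \<otimes>\<^bsub>G\<^esub> (inv\<^bsub>G\<^esub> h \<otimes>\<^bsub>G\<^esub> inv\<^bsub>G\<^esub> g))
        (g \<otimes>\<^bsub>G\<^esub> h \<otimes>\<^bsub>G\<^esub> (inv\<^bsub>G\<^esub> h \<otimes>\<^bsub>G\<^esub> inv\<^bsub>G\<^esub> g))"
      using g hG by simp
    moreover have "g \<otimes>\<^bsub>G\<^esub> h \<otimes>\<^bsub>G\<^esub> (inv\<^bsub>G\<^esub> h \<otimes>\<^bsub>G\<^esub> inv\<^bsub>G\<^esub> g) = \<one>\<^bsub>G\<^esub>"
      using g hG inv_mult_group[OF g hG] r_inv[of "g \<otimes>\<^bsub>G\<^esub> h"] by simp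
    ultimately show ?thesis
      using g hG by (simp add: m_assoc)
  qed
  then have "{h \<otimes>\<^bsub>G\<^esub> g \<otimes>\<^bsub>G\<^esub> inv\<^bsub>G\<^esub> h \<otimes>\<^bsub>G\<^esub> inv\<^bsub>G\<^esub> g | h g.
      h \<in> lower_central G (Suc k) \<and> g \<in> carrier G} \<subseteq> ?H"
    by blast
  from generate_subgroup_incl[OF this coord_cong_one_subgroup[OF assms(1) I]]
  show ?case
    using Suc.prems by (auto simp: commutator_subgroup_def)
qed


section \<open>Pulling functions back along maps of representation sets\<close>

text \<open>
  Both the action of an automorphism and the restriction from degree \<open>m + 1\<close> to degree \<open>m\<close> are
  composition of functions with a map of representation sets.
\<close>

definition pullback :: "'s set \<Rightarrow> ('s \<Rightarrow> 't) \<Rightarrow> ('t \<Rightarrow> complex) \<Rightarrow> 's \<Rightarrow> complex" where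
  "pullback S \<phi> f = (\<lambda>r\<in>S. f (\<phi> r))"

lemma act_eq_pullback: "act m G \<sigma> = pullback (reps m G) (\<lambda>r. compose (carrier G) r \<sigma>)"
  by (rule ext) (simp add: act_def pullback_def)

lemma pullback_ops:
  assumes "\<phi> \<in> S \<rightarrow> T"
  shows "pullback S \<phi> (\<lambda>r\<in>T. 1) = (\<lambda>r\<in>S. 1)"
    and "pullback S \<phi> (\<lambda>r\<in>T. f r + g r) = (\<lambda>r\<in>S. pullback S \<phi> f r + pullback S \<phi> g r)"
    and "pullback S \<phi> (\<lambda>r\<in>T. f r - g r) = (\<lambda>r\<in>S. pullback S \<phi> f r - pullback S \<phi> g r)"
    and "pullback S \<phi> (\<lambda>r\<in>T. f r * g r) = (\<lambda>r\<in>S. pullback S \<phi> f r * pullback S \<phi> g r)"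
    and "pullback S \<phi> (\<lambda>r\<in>T. of_rat q * f r) = (\<lambda>r\<in>S. of_rat q * pullback S \<phi> f r)"
  using assms by (auto simp: pullback_def Pi_iff)

text \<open>
  The functions that are pulled back into the ring form a rational subalgebra, so it is enough to
  inspect the coordinate functions.
\<close>

lemma pullback_ring_hom:
  assumes \<phi>: "\<phi> \<in> reps m G \<rightarrow> reps p H"
    and gen: "\<And>i j x. i < p \<Longrightarrow> j < p \<Longrightarrow> x \<in> carrier H \<Longrightarrow>
      pullback (reps m G) \<phi> (coord p H i j x) \<in> carrier (rep_ring m G)"
  shows "pullback (reps m G) \<phi> \<in> Ring.ring_hom (rep_ring p H) (rep_ring m G)"
proof -
  let ?V = "{f \<in> carrier (rep_ring p H). pullback (reps m G) \<phi> f \<in> carrier (rep_ring m G)}"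
  have "rat_subalgebra (reps p H) ?V"
  proof (rule rat_subalgebraI)
    show "?V \<subseteq> extensional (reps p H)"
      using rep_ring_closed(1) by blast
    show "(\<lambda>r\<in>reps p H. of_rat q * f r) \<in> ?V" if "f \<in> ?V" for q :: rat and f
      using that by (simp add: pullback_ops(5)[OF \<phi>] rep_ring_closed(5))
  qed (simp_all add: pullback_ops(1,2,4)[OF \<phi>] rep_ring_closed(2-4))
  then have "carrier (rep_ring p H) \<subseteq> ?V"
    using gen coord_in_rep_ring by (intro rep_ring_minimal) auto
  then show ?thesis
    by (intro ring_hom_memI) (auto simp: rep_ring_simps pullback_ops[OF \<phi>])
qed

lemma pullback_surj:
  assumes \<phi>: "\<phi> \<in> reps m G \<rightarrow> reps p H"
    and hom: "pullback (reps m G) \<phi> \<in> Ring.ring_hom (rep_ring p H) (rep_ring m G)"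
    and gen: "\<And>i j x. i < m \<Longrightarrow> j < m \<Longrightarrow> x \<in> carrier G \<Longrightarrow>
      coord m G i j x \<in> pullback (reps m G) \<phi> ` carrier (rep_ring p H)"
  shows "pullback (reps m G) \<phi> ` carrier (rep_ring p H) = carrier (rep_ring m G)"
proof
  show "pullback (reps m G) \<phi> ` carrier (rep_ring p H) \<subseteq> carrier (rep_ring m G)"
    using ring_hom_memE(1)[OF hom] by blast
  note cl = rep_ring_closed[where m = p and G = H]
  have "rat_subalgebra (reps m G) (pullback (reps m G) \<phi> ` carrier (rep_ring p H))"
  proof (rule rat_subalgebraI)
    show "pullback (reps m G) \<phi> ` carrier (rep_ring p H) \<subseteq> extensional (reps m G)"
      by (auto simp: pullback_def)
    show "(\<lambda>r\<in>reps m G. 1) \<in> pullback (reps m G) \<phi> ` carrier (rep_ring p H)"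
      using pullback_ops(1)[OF \<phi>] cl(2) by (metis image_eqI)
  next
    fix f g
    assume "f \<in> pullback (reps m G) \<phi> ` carrier (rep_ring p H)"
      and "g \<in> pullback (reps m G) \<phi> ` carrier (rep_ring p H)"
    then obtain f' g' where f': "f' \<in> carrier (rep_ring p H)" "f = pullback (reps m G) \<phi> f'"
      and g': "g' \<in> carrier (rep_ring p H)" "g = pullback (reps m G) \<phi> g'"
      by blast
    show "(\<lambda>r\<in>reps m G. f r + g r) \<in> pullback (reps m G) \<phi> ` carrier (rep_ring p H)"
      unfolding f'(2) g'(2) pullback_ops(2)[OF \<phi>, symmetric]
      by (rule imageI) (rule cl(3)[OF f'(1) g'(1)])
    show "(\<lambda>r\<in>reps m G. f r * g r) \<in> pullback (reps m G) \<phi> ` carrier (rep_ring p H)"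
      unfolding f'(2) g'(2) pullback_ops(4)[OF \<phi>, symmetric]
      by (rule imageI) (rule cl(4)[OF f'(1) g'(1)])
  next
    fix q :: rat and f
    assume "f \<in> pullback (reps m G) \<phi> ` carrier (rep_ring p H)"
    then obtain f' where f': "f' \<in> carrier (rep_ring p H)" "f = pullback (reps m G) \<phi> f'"
      by blast
    show "(\<lambda>r\<in>reps m G. of_rat q * f r) \<in> pullback (reps m G) \<phi> ` carrier (rep_ring p H)"
      unfolding f'(2) pullback_ops(5)[OF \<phi>, symmetric]
      by (rule imageI) (rule cl(5)[OF f'(1)])
  qed
  then show "carrier (rep_ring m G) \<subseteq> pullback (reps m G) \<phi> ` carrier (rep_ring p H)"
    using gen by (intro rep_ring_minimal)
qed

lemma ring_hom_J_ideal:
  assumes "group H" "Y \<subseteq> carrier H" and hom: "h \<in> Ring.ring_hom (rep_ring p H) (rep_ring m G)"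
    and I: "ideal I (rep_ring m G)"
    and gen: "\<And>i j x. i < p \<Longrightarrow> j < p \<Longrightarrow> x \<in> Y \<Longrightarrow> h (s_coord p H i j x) \<in> I"
  shows "h ` J_ideal p H Y \<subseteq> I"
proof -
  interpret h: ring_hom_ring "rep_ring p H" "rep_ring m G" h
    using hom by (intro ring_hom_ringI2 ring_rep_ring)
  have "{s_coord p H i j x | i j x. i < p \<and> j < p \<and> x \<in> Y}
      \<subseteq> {f \<in> carrier (rep_ring p H). h f \<in> I}"
    using gen assms(1,2) by (auto intro: s_coord_in_rep_ring)
  from h.R.genideal_minimal[OF h.ideal_vimage[OF I] this] show ?thesis
    by (auto simp: J_ideal_def)
qed

lemma ring_hom_J_power:
  assumes "group H" "Y \<subseteq> carrier H" and hom: "h \<in> Ring.ring_hom (rep_ring p H) (rep_ring m G)"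
    and J: "h ` J_ideal p H Y \<subseteq> J_ideal m G X"
  shows "h ` J_power p H Y k \<subseteq> J_power m G X k"
proof (induction k)
  case 0
  show ?case
    using ring_hom_memE(1)[OF hom] by (auto simp: J_power_0)
next
  case (Suc k)
  have "h f \<in> J_power m G X (Suc k)" if "f \<in> J_power p H Y (Suc k)" for f
    using that unfolding J_power_Suc
  proof (induction f rule: ideal_prod.induct)
    case (prod a b)
    have "a \<in> carrier (rep_ring p H)" "b \<in> carrier (rep_ring p H)"
      using prod ideal_closed(1)[OF ideal_J_power[OF assms(1,2), of p k]]
        ideal_closed(1)[OF ideal_J_ideal[OF assms(1,2), of p]] by auto
    then have "h (a \<otimes>\<^bsub>rep_ring p H\<^esub> b) = h a \<otimes>\<^bsub>rep_ring m G\<^esub> h b"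
      by (rule ring_hom_memE(2)[OF hom])
    then show ?case
      using prod Suc.IH J by (auto intro!: ideal_prod.prod)
  next
    case (sum a b)
    have "a \<in> carrier (rep_ring p H)" "b \<in> carrier (rep_ring p H)"
      using sum.hyps ideal_closed(1)[OF ideal_J_power[OF assms(1,2)], of p "Suc k"]
      by (auto simp: J_power_Suc)
    then have "h (a \<oplus>\<^bsub>rep_ring p H\<^esub> b) = h a \<oplus>\<^bsub>rep_ring m G\<^esub> h b"
      by (rule ring_hom_memE(3)[OF hom])
    then show ?case
      using sum.IH by (auto intro!: ideal_prod.sum)
  qed
  then show ?case
    by blast
qed

lemma ideal_surj_image:
  assumes "ring_hom_ring R S h" "ideal I R" "h ` carrier R = carrier S"
  shows "ideal (h ` I) S"
proof -
  interpret h: ring_hom_ring R S h by fact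
  interpret I: ideal I R by fact
  show ?thesis
  proof (rule idealI[OF h.S.ring_axioms])
    show "subgroup (h ` I) (add_monoid S)"
      using h.img_is_add_subgroup[OF I.a_subgroup] .
  next
    fix a x
    assume "a \<in> h ` I" "x \<in> carrier S"
    then obtain b y where b: "b \<in> I" "a = h b" and y: "y \<in> carrier R" "x = h y"
      using assms(3) by blast
    then show "x \<otimes>\<^bsub>S\<^esub> a \<in> h ` I"
      using I.I_l_closed[OF b(1) y(1)] h.hom_mult[OF y(1) I.Icarr[OF b(1)]] by (metis image_eqI)
    show "a \<otimes>\<^bsub>S\<^esub> x \<in> h ` I"
      using b y I.I_r_closed[OF b(1) y(1)] h.hom_mult[OF I.Icarr[OF b(1)] y(1)]
      by (metis image_eqI)
  qed
qed


section \<open>Automorphisms acting on the powers of the ideal\<close>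

lemma compose_in_reps:
  assumes "group G" "\<sigma> \<in> auto G"
  shows "(\<lambda>r. compose (carrier G) r \<sigma>) \<in> reps m G \<rightarrow> reps m G"
  using compose_reps[OF assms(1) _ assms(2)] by auto

lemma auto_closed: "\<sigma> \<in> auto G \<Longrightarrow> x \<in> carrier G \<Longrightarrow> \<sigma> x \<in> carrier G"
  by (auto simp: auto_def hom_def)

lemma act_ring_hom:
  assumes "group G" "\<sigma> \<in> auto G"
  shows "act m G \<sigma> \<in> Ring.ring_hom (rep_ring m G) (rep_ring m G)"
  unfolding act_eq_pullback
  by (rule pullback_ring_hom[OF compose_in_reps[OF assms]])
    (simp add: act_eq_pullback[symmetric] act_coord[OF assms] coord_in_rep_ring auto_closed[OF assms(2)])

lemma act_J_power:
  assumes "group G" "X \<subseteq> carrier G" "generate G X = carrier G" "\<sigma> \<in> auto G"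
  shows "act m G \<sigma> ` J_power m G X k \<subseteq> J_power m G X k"
proof (rule ring_hom_J_power[OF assms(1,2) act_ring_hom[OF assms(1,4)]],
    rule ring_hom_J_ideal[OF assms(1,2) act_ring_hom[OF assms(1,4)] ideal_J_ideal[OF assms(1,2)]])
  fix i j x
  assume ij: "i < m" "j < m" and x: "x \<in> X"
  then have xG: "x \<in> carrier G"
    using assms by auto
  have "act m G \<sigma> (s_coord m G i j x) = s_coord m G i j (\<sigma> x)"
  proof
    fix r
    show "act m G \<sigma> (s_coord m G i j x) r = s_coord m G i j (\<sigma> x) r"
      using xG compose_reps[OF assms(1) _ assms(4), of r m]
      by (cases "r \<in> reps m G") (simp_all add: act_def s_coord_def coord_def compose_eq)
  qed
  also have "\<dots> \<in> J_ideal m G X"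
    using coord_cong_J_ideal[OF assms(1-3) auto_closed[OF assms(4) xG], of m] ij
    by (simp add: coord_cong_def s_coord_altdef[OF assms(1)])
  finally show "act m G \<sigma> (s_coord m G i j x) \<in> J_ideal m G X" .
qed

text \<open>Invariance under the inverse automorphism provides the preimage.\<close>

lemma act_J_power_surj:
  assumes "group G" "X \<subseteq> carrier G" "generate G X = carrier G" and \<sigma>: "\<sigma> \<in> auto G"
    and f: "f \<in> J_power m G X k"
  obtains g where "g \<in> J_power m G X k" "act m G \<sigma> g = f"
proof
  interpret group G by fact
  define \<tau> where "\<tau> = restrict (inv_into (carrier G) \<sigma>) (carrier G)"
  have \<tau>: "\<tau> \<in> auto G"
    using \<sigma> by (simp add: \<tau>_def auto_def restrict_inv_into_hom restrict_inv_into_Bij)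
  show "act m G \<tau> f \<in> J_power m G X k"
    using act_J_power[OF assms(1-3) \<tau>] f by blast
  have ext: "f \<in> extensional (reps m G)"
    using f ideal_closed(1)[OF ideal_J_power[OF assms(1,2)]] rep_ring_closed(1) by blast
  have "compose (carrier G) (compose (carrier G) r \<sigma>) \<tau> = r" if "r \<in> reps m G" for r
  proof
    fix x
    have "\<sigma> (\<tau> x) = x" if "x \<in> carrier G"
      using \<sigma> that by (auto simp: \<tau>_def auto_def Bij_def bij_betw_def f_inv_into_f)
    then show "compose (carrier G) (compose (carrier G) r \<sigma>) \<tau> x = r x"
      using \<open>r \<in> reps m G\<close> auto_closed[OF \<tau>]
      by (cases "x \<in> carrier G") (auto simp: compose_def reps_def extensional_def)
  qed
  then show "act m G \<sigma> (act m G \<tau> f) = f"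
    using ext compose_reps[OF assms(1) _ \<sigma>]
    by (intro extensionalityI[of _ "reps m G"]) (auto simp: act_def)
qed

lemma carrier_Mod: "carrier (A Mod H) = rcosets\<^bsub>A\<^esub> H"
  by (simp add: FactGroup_def)

lemma kernel_AutoGroup_iff:
  "\<sigma> \<in> kernel (AutoGroup G) (AutoGroup Q) (\<lambda>\<sigma>. \<lambda>C\<in>carrier Q. F \<sigma> C)
    \<longleftrightarrow> \<sigma> \<in> auto G \<and> (\<forall>C\<in>carrier Q. F \<sigma> C = C)"
  by (auto simp: kernel_def AutoGroup_def BijGroup_def restrict_def fun_eq_iff)

text \<open>
  Let \<open>I\<close> be the power \<open>J\<^sup>k\<^sup>+\<^sup>1\<close> and \<open>d = f\<^sup>\<sigma> - f\<close>.  If \<open>\<sigma>\<close> fixes the coset of \<open>f\<close>, then \<open>f\<^sup>\<sigma>\<close> lies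
  in it and \<open>d\<close> is in \<open>I\<close>.  Conversely \<open>(h + f)\<^sup>\<sigma> = (h\<^sup>\<sigma> + d) + f\<close>, and since \<open>\<sigma>\<close> maps \<open>I\<close> onto \<open>I\<close>,
  the element \<open>h\<^sup>\<sigma> + d\<close> runs through all of \<open>I\<close> when \<open>h\<close> does.
\<close>

lemma mem_D_filt_iff:
  assumes "group G" "X \<subseteq> carrier G" "generate G X = carrier G"
  shows "\<sigma> \<in> D_filt m G X k \<longleftrightarrow> \<sigma> \<in> auto G \<and>
    (\<forall>f\<in>J_ideal m G X. (\<lambda>r\<in>reps m G. act m G \<sigma> f r - f r) \<in> J_power m G X (Suc k))"
proof -
  let ?S = "reps m G"
  let ?J = "J_ideal m G X"
  let ?I = "J_power m G X (Suc k)"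
  let ?C = "\<lambda>f. (\<lambda>h. \<lambda>r\<in>?S. h r + f r) ` ?I"
  note I = ideal_closed[OF ideal_J_power[OF assms(1,2), of m "Suc k"]]
  have ext: "f \<in> extensional ?S" if "f \<in> ?J \<or> f \<in> ?I" for f
    using that I(1) ideal_closed(1)[OF ideal_J_ideal[OF assms(1,2)]] rep_ring_closed(1) by blast
  have carr: "carrier (J_quotient m G X k) = ?C ` ?J"
    by (auto simp: J_quotient_def carrier_Mod RCOSETS_def r_coset_def rep_ring_simps)
  have mem_iff: "g \<in> ?C f \<longleftrightarrow> (\<lambda>r\<in>?S. g r - f r) \<in> ?I" if g: "g \<in> extensional ?S" for f g
  proof
    assume "g \<in> ?C f"
    then obtain h where h: "h \<in> ?I" "g = (\<lambda>r\<in>?S. h r + f r)"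
      by blast
    then have "(\<lambda>r\<in>?S. g r - f r) = h"
      using ext[of h] by (intro extensionalityI[of _ ?S]) auto
    with h show "(\<lambda>r\<in>?S. g r - f r) \<in> ?I"
      by simp
  next
    assume d: "(\<lambda>r\<in>?S. g r - f r) \<in> ?I"
    have "g = (\<lambda>r\<in>?S. (\<lambda>r\<in>?S. g r - f r) r + f r)"
      using g by (intro extensionalityI[of _ ?S]) auto
    from this d show "g \<in> ?C f"
      by (rule image_eqI)
  qed
  have act_ext: "act m G \<sigma> f \<in> extensional ?S" for f
    by (simp add: act_def)
  have "(act m G \<sigma> ` ?C f = ?C f) \<longleftrightarrow> (\<lambda>r\<in>?S. act m G \<sigma> f r - f r) \<in> ?I"
    if \<sigma>: "\<sigma> \<in> auto G" and f: "f \<in> ?J" for f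
  proof
    assume eq: "act m G \<sigma> ` ?C f = ?C f"
    have "f \<in> ?C f"
      using I(2) ext[of f] f by (simp add: mem_iff)
    then have "act m G \<sigma> f \<in> ?C f"
      using eq by blast
    then show "(\<lambda>r\<in>?S. act m G \<sigma> f r - f r) \<in> ?I"
      by (simp add: mem_iff[OF act_ext])
  next
    assume d: "(\<lambda>r\<in>?S. act m G \<sigma> f r - f r) \<in> ?I" (is "?d \<in> ?I")
    have act_add': "act m G \<sigma> (\<lambda>r\<in>?S. h r + f r) = (\<lambda>r\<in>?S. act m G \<sigma> h r + act m G \<sigma> f r)" for h
      unfolding act_eq_pullback by (rule pullback_ops(2)[OF compose_in_reps[OF assms(1) \<sigma>]])
    show "act m G \<sigma> ` ?C f = ?C f"
    proof (intro equalityI subsetI)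
      fix g
      assume "g \<in> act m G \<sigma> ` ?C f"
      then obtain h where h: "h \<in> ?I" "g = act m G \<sigma> (\<lambda>r\<in>?S. h r + f r)"
        by blast
      have "g = (\<lambda>r\<in>?S. (\<lambda>r\<in>?S. act m G \<sigma> h r + ?d r) r + f r)"
        unfolding h(2) act_add' by auto
      moreover have "(\<lambda>r\<in>?S. act m G \<sigma> h r + ?d r) \<in> ?I"
        using I(3)[OF _ d] act_J_power[OF assms \<sigma>] h(1) by blast
      ultimately show "g \<in> ?C f"
        by (rule image_eqI)
    next
      fix g
      assume "g \<in> ?C f"
      then obtain h where h: "h \<in> ?I" "g = (\<lambda>r\<in>?S. h r + f r)"
        by blast
      obtain h' where h': "h' \<in> ?I" "act m G \<sigma> h' = (\<lambda>r\<in>?S. h r - ?d r)"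
        using act_J_power_surj[OF assms \<sigma> I(6)[OF h(1) d]] by blast
      have "g = act m G \<sigma> (\<lambda>r\<in>?S. h' r + f r)"
        unfolding act_add' h'(2) h(2) by auto
      then show "g \<in> act m G \<sigma> ` ?C f"
        using h'(1) by blast
    qed
  qed
  moreover have "\<sigma> \<in> D_filt m G X k \<longleftrightarrow>
      \<sigma> \<in> auto G \<and> (\<forall>C\<in>carrier (J_quotient m G X k). act m G \<sigma> ` C = C)"
    unfolding D_filt_def by (rule kernel_AutoGroup_iff)
  ultimately show ?thesis
    unfolding carr by (simp only: ball_simps cong: conj_cong ball_cong)
qed


section \<open>The Andreadakis-Johnson filtration\<close>

lemma A_filt_lower_central:
  assumes "group G" "\<sigma> \<in> A_filt G k" "x \<in> carrier G"
  shows "\<exists>c\<in>lower_central G (Suc k). \<sigma> x = c \<otimes>\<^bsub>G\<^esub> x"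
proof -
  interpret group G by fact
  let ?L = "lower_central G (Suc k)"
  have fix_cosets: "\<sigma> ` C = C" if "C \<in> rcosets\<^bsub>G\<^esub> ?L" for C
    using assms(2) that by (simp add: A_filt_def kernel_AutoGroup_iff flip: carrier_Mod)
  have "?L #>\<^bsub>G\<^esub> x \<in> rcosets\<^bsub>G\<^esub> ?L"
    using assms(3) by (auto simp: RCOSETS_def)
  then have eq: "\<sigma> ` (?L #>\<^bsub>G\<^esub> x) = ?L #>\<^bsub>G\<^esub> x"
    by (rule fix_cosets)
  have "\<one>\<^bsub>G\<^esub> \<otimes>\<^bsub>G\<^esub> x \<in> ?L #>\<^bsub>G\<^esub> x"
    unfolding r_coset_def using one_in_lower_central[OF assms(1), of k] by blast
  then have "\<sigma> x \<in> ?L #>\<^bsub>G\<^esub> x"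
    using eq assms(3) by (metis imageI l_one)
  then show "\<exists>c\<in>?L. \<sigma> x = c \<otimes>\<^bsub>G\<^esub> x"
    by (auto simp: r_coset_def)
qed

text \<open>
  The functions that \<open>\<sigma>\<close> moves by an element of \<open>I\<close> form a rational subalgebra, closed under products
  by \<open>(fg)\<^sup>\<sigma> - fg = (f\<^sup>\<sigma> - f) g\<^sup>\<sigma> + (g\<^sup>\<sigma> - g) f\<close>; the hypothesis says that it contains the coordinate
  functions.
\<close>

lemma act_cong_on_rep_ring:
  assumes "group G" "\<sigma> \<in> auto G" and I: "ideal I (rep_ring m G)"
    and cong: "\<And>x. x \<in> carrier G \<Longrightarrow> coord_cong m G I (\<sigma> x) x"
    and f: "f \<in> carrier (rep_ring m G)"
  shows "(\<lambda>r\<in>reps m G. act m G \<sigma> f r - f r) \<in> I"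
proof -
  let ?S = "reps m G"
  let ?R = "rep_ring m G"
  let ?V = "{f \<in> carrier ?R. (\<lambda>r\<in>?S. act m G \<sigma> f r - f r) \<in> I}"
  note cl = ideal_closed[OF I]
  have \<phi>: "(\<lambda>r. compose (carrier G) r \<sigma>) \<in> ?S \<rightarrow> ?S"
    using compose_in_reps[OF assms(1,2)] .
  note ops = pullback_ops[OF \<phi>, folded act_eq_pullback]
  have "rat_subalgebra ?S ?V"
  proof (rule rat_subalgebraI)
    show "?V \<subseteq> extensional ?S"
      using rep_ring_closed(1) by blast
    have "(\<lambda>r\<in>?S. act m G \<sigma> (\<lambda>r\<in>?S. 1) r - (\<lambda>r\<in>?S. 1) r) = (\<lambda>r\<in>?S. 0)"
      by (auto simp: ops)
    then show "(\<lambda>r\<in>?S. 1) \<in> ?V"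
      using cl(2) rep_ring_closed(2) by (simp only: mem_Collect_eq simp_thms)
  next
    fix f g
    assume "f \<in> ?V" "g \<in> ?V"
    then have f: "f \<in> carrier ?R" "(\<lambda>r\<in>?S. act m G \<sigma> f r - f r) \<in> I" (is "?df \<in> I")
      and g: "g \<in> carrier ?R" "(\<lambda>r\<in>?S. act m G \<sigma> g r - g r) \<in> I" (is "?dg \<in> I")
      by auto
    have "(\<lambda>r\<in>?S. act m G \<sigma> (\<lambda>r\<in>?S. f r + g r) r - (\<lambda>r\<in>?S. f r + g r) r)
        = (\<lambda>r\<in>?S. ?df r + ?dg r)"
      by (auto simp: ops)
    then show "(\<lambda>r\<in>?S. f r + g r) \<in> ?V"
      using cl(3)[OF f(2) g(2)] rep_ring_closed(3)[OF f(1) g(1)]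
      by (simp only: mem_Collect_eq simp_thms)
    have ag: "act m G \<sigma> g \<in> carrier ?R"
      using ring_hom_memE(1)[OF act_ring_hom[OF assms(1,2)] g(1)] .
    have "(\<lambda>r\<in>?S. act m G \<sigma> (\<lambda>r\<in>?S. f r * g r) r - (\<lambda>r\<in>?S. f r * g r) r)
        = (\<lambda>r\<in>?S. (\<lambda>r\<in>?S. ?df r * act m G \<sigma> g r) r + (\<lambda>r\<in>?S. ?dg r * f r) r)"
      by (auto simp: ops algebra_simps)
    then show "(\<lambda>r\<in>?S. f r * g r) \<in> ?V"
      using cl(3)[OF cl(4)[OF f(2) ag] cl(4)[OF g(2) f(1)]] rep_ring_closed(4)[OF f(1) g(1)]
      by (simp only: mem_Collect_eq simp_thms)
  next
    fix q :: rat and f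
    assume "f \<in> ?V"
    then have f: "f \<in> carrier ?R" "(\<lambda>r\<in>?S. act m G \<sigma> f r - f r) \<in> I" (is "?df \<in> I")
      by auto
    have "(\<lambda>r\<in>?S. act m G \<sigma> (\<lambda>r\<in>?S. of_rat q * f r) r - (\<lambda>r\<in>?S. of_rat q * f r) r)
        = (\<lambda>r\<in>?S. of_rat q * ?df r)"
      by (auto simp: ops(5) algebra_simps)
    then show "(\<lambda>r\<in>?S. of_rat q * f r) \<in> ?V"
      using cl(5)[OF f(2), of q] rep_ring_closed(5)[OF f(1), of q]
      by (simp only: mem_Collect_eq simp_thms)
  qed
  moreover have "coord m G i j x \<in> ?V" if "i < m" "j < m" "x \<in> carrier G" for i j x
  proof -
    have "(\<lambda>r\<in>?S. act m G \<sigma> (coord m G i j x) r - coord m G i j x r)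
        = (\<lambda>r\<in>?S. r (\<sigma> x) $$ (i, j) - r x $$ (i, j))"
      unfolding act_coord[OF assms(1,2) that(3)] by (auto simp: coord_def)
    then show ?thesis
      using cong that by (simp add: coord_cong_def coord_in_rep_ring)
  qed
  ultimately have "carrier ?R \<subseteq> ?V"
    by (rule rep_ring_minimal)
  with f show ?thesis
    by blast
qed

theorem A_filt_subset_D_filt:
  assumes "group G" "X \<subseteq> carrier G" "generate G X = carrier G"
  shows "A_filt G k \<subseteq> D_filt m G X k"
proof
  fix \<sigma>
  assume \<sigma>A: "\<sigma> \<in> A_filt G k"
  interpret group G by fact
  let ?I = "J_power m G X (Suc k)"
  have \<sigma>: "\<sigma> \<in> auto G"
    using \<sigma>A by (simp add: A_filt_def kernel_AutoGroup_iff)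
  have I: "ideal ?I (rep_ring m G)"
    using ideal_J_power[OF assms(1,2)] .
  have "coord_cong m G ?I (\<sigma> x) x" if x: "x \<in> carrier G" for x
  proof -
    obtain c where c: "c \<in> lower_central G (Suc k)" "\<sigma> x = c \<otimes>\<^bsub>G\<^esub> x"
      using A_filt_lower_central[OF assms(1) \<sigma>A x] by blast
    have "c \<in> carrier G"
      using c(1) lower_central_subset[OF assms(1)] by blast
    then have "coord_cong m G ?I (c \<otimes>\<^bsub>G\<^esub> x) (\<one>\<^bsub>G\<^esub> \<otimes>\<^bsub>G\<^esub> x)"
      using coord_cong_lower_central[OF assms c(1)] x by (intro coord_cong_mult_right[OF I]) auto
    then show ?thesis
      using c(2) x by simp
  qed
  then show "\<sigma> \<in> D_filt m G X k"
    using act_cong_on_rep_ring[OF assms(1) \<sigma> I] ideal_closed(1)[OF ideal_J_ideal[OF assms(1,2)]]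
    by (auto simp: mem_D_filt_iff[OF assms] \<sigma>)
qed


section \<open>Stabilisation of representations\<close>

definition stabilise ::
  "nat \<Rightarrow> ('a, 'b) monoid_scheme \<Rightarrow> ('a \<Rightarrow> complex mat) \<Rightarrow> 'a \<Rightarrow> complex mat" where
  "stabilise m G r =
    (\<lambda>x\<in>carrier G. four_block_mat (r x) (0\<^sub>m m 1) (0\<^sub>m 1 m) (1\<^sub>m 1))"

lemma stabilise_in_reps:
  assumes "group G" "r \<in> reps m G"
  shows "stabilise m G r \<in> reps (Suc m) G"
proof -
  interpret group G by fact
  let ?b = "\<lambda>A :: complex mat. four_block_mat A (0\<^sub>m m 1) (0\<^sub>m 1 m) (1\<^sub>m 1)"
  have r: "r x \<in> carrier_mat m m" "det (r x) = 1" if "x \<in> carrier G" for x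
    using assms(2) that by (auto simp: reps_def hom_def SL_def Pi_iff)
  have rm: "r (x \<otimes>\<^bsub>G\<^esub> y) = r x * r y" if "x \<in> carrier G" "y \<in> carrier G" for x y
    using assms(2) that by (auto simp: reps_def hom_def SL_def)
  have det: "det (?b (r x)) = 1" if "x \<in> carrier G" for x
    using det_four_block_mat_upper_right_zero[OF r(1)[OF that] refl zero_carrier_mat one_carrier_mat]
      r(2)[OF that]
    by simp
  have dim: "?b (r x) \<in> carrier_mat (Suc m) (Suc m)" if "x \<in> carrier G" for x
    using r(1)[OF that] by (auto intro!: carrier_matI)
  have mult: "?b (r x * r y) = ?b (r x) * ?b (r y)" if "x \<in> carrier G" "y \<in> carrier G" for x y
    using r(1)[OF that(1)] r(1)[OF that(2)]
    by (subst mult_four_block_mat[where ?nr1.0 = m and ?n1.0 = m and ?n2.0 = 1 and ?nr2.0 = 1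
          and ?nc1.0 = m and ?nc2.0 = 1]) auto
  have "stabilise m G r \<in> hom G (SL (Suc m))"
  proof (rule homI)
    show "stabilise m G r x \<in> carrier (SL (Suc m))" if "x \<in> carrier G" for x
      using det[OF that] dim[OF that] that by (simp add: SL_def stabilise_def)
    show "stabilise m G r (x \<otimes>\<^bsub>G\<^esub> y) = stabilise m G r x \<otimes>\<^bsub>SL (Suc m)\<^esub> stabilise m G r y"
      if "x \<in> carrier G" "y \<in> carrier G" for x y
      using that mult[OF that] by (simp add: SL_def stabilise_def rm)
  qed
  then show ?thesis
    by (simp add: reps_def stabilise_def)
qed

lemma stabilise_index:
  assumes "r \<in> reps m G" "x \<in> carrier G" "i < Suc m" "j < Suc m"
  shows "stabilise m G r x $$ (i, j)
    = (if i < m \<and> j < m then r x $$ (i, j) else if i = j then 1 else 0)"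
  using rep_carrier[OF assms(1,2)] assms by (auto simp: stabilise_def)

lemma stabilise_compose:
  assumes "\<sigma> \<in> auto G"
  shows "stabilise m G (compose (carrier G) r \<sigma>) = compose (carrier G) (stabilise m G r) \<sigma>"
  using auto_closed[OF assms] by (auto simp: stabilise_def compose_def)

text \<open>
  The coordinate functions of degree \<open>m + 1\<close> restrict to those of degree \<open>m\<close> and, in the last row
  and column, to the constants \<open>0\<close> and \<open>1\<close>.
\<close>

lemma stabilise_pullback:
  fixes m :: nat and G (structure)
  defines "\<pi> \<equiv> pullback (reps m G) (stabilise m G)"
  assumes "group G"
  shows stabilise_pullback_hom: "\<pi> \<in> Ring.ring_hom (rep_ring (Suc m) G) (rep_ring m G)"
    and stabilise_pullback_surj: "\<pi> ` carrier (rep_ring (Suc m) G) = carrier (rep_ring m G)"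
    and stabilise_pullback_s_coord:
      "\<And>i j x. i < Suc m \<Longrightarrow> j < Suc m \<Longrightarrow> x \<in> carrier G \<Longrightarrow> \<pi> (s_coord (Suc m) G i j x)
        = (if i < m \<and> j < m then s_coord m G i j x else (\<lambda>r\<in>reps m G. 0))"
proof -
  have \<phi>: "stabilise m G \<in> reps m G \<rightarrow> reps (Suc m) G"
    using stabilise_in_reps[OF assms(2)] by auto
  have coord: "\<pi> (coord (Suc m) G i j x) = (if i < m \<and> j < m then coord m G i j x
      else (\<lambda>r\<in>reps m G. of_rat (if i = j then 1 else 0)))"
    if "i < Suc m" "j < Suc m" "x \<in> carrier G" for i j x
    using that stabilise_in_reps[OF assms(2)]
    by (auto simp: \<pi>_def pullback_def coord_def stabilise_index)
  show hom: "\<pi> \<in> Ring.ring_hom (rep_ring (Suc m) G) (rep_ring m G)"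
    unfolding \<pi>_def
  proof (rule pullback_ring_hom[OF \<phi>], fold \<pi>_def)
    fix i j x
    assume "i < Suc m" "j < Suc m" "x \<in> carrier G"
    then show "\<pi> (coord (Suc m) G i j x) \<in> carrier (rep_ring m G)"
      using rep_ring_const[where m = m and G = G and q = "if i = j then 1 else 0"] coord_in_rep_ring[of i m j x G]
      by (simp only: coord split: if_split) simp
  qed
  show "\<pi> ` carrier (rep_ring (Suc m) G) = carrier (rep_ring m G)"
    unfolding \<pi>_def
  proof (rule pullback_surj[OF \<phi> hom[unfolded \<pi>_def]], fold \<pi>_def)
    fix i j x
    assume "i < m" "j < m" "x \<in> carrier G"
    then show "coord m G i j x \<in> \<pi> ` carrier (rep_ring (Suc m) G)"
      using coord[of i j x] coord_in_rep_ring[of i "Suc m" j x G] by (intro image_eqI) auto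
  qed
  show "\<pi> (s_coord (Suc m) G i j x)
      = (if i < m \<and> j < m then s_coord m G i j x else (\<lambda>r\<in>reps m G. 0))"
    if "i < Suc m" "j < Suc m" "x \<in> carrier G" for i j x
    using that stabilise_in_reps[OF assms(2)]
    by (intro extensionalityI[of _ "reps m G"])
      (simp_all add: \<pi>_def pullback_def s_coord_def coord_def stabilise_index)
qed

text \<open>
  Surjectivity on the rings makes the image an ideal, and this ideal contains the generators of
  the ideal of degree \<open>m\<close>.
\<close>

lemma stabilise_pullback_J_ideal:
  assumes "group G" "X \<subseteq> carrier G"
  shows "pullback (reps m G) (stabilise m G) ` J_ideal (Suc m) G X = J_ideal m G X"
    (is "?\<pi> ` _ = _")
proof
  note hom = stabilise_pullback_hom[OF assms(1), of m]
  note J = ideal_J_ideal[OF assms]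
  show "?\<pi> ` J_ideal (Suc m) G X \<subseteq> J_ideal m G X"
  proof (rule ring_hom_J_ideal[OF assms hom J])
    fix i j x
    assume "i < Suc m" "j < Suc m" "x \<in> X"
    moreover have "s_coord m G i j x \<in> J_ideal m G X" if "i < m" "j < m"
      using that \<open>x \<in> X\<close> by (auto simp: J_ideal_def genideal_def)
    moreover have "x \<in> carrier G"
      using \<open>x \<in> X\<close> assms(2) by blast
    ultimately show "?\<pi> (s_coord (Suc m) G i j x) \<in> J_ideal m G X"
      using ideal_closed(2)[OF J] by (simp only: stabilise_pullback_s_coord[OF assms(1)] split: if_split) simp
  qed
  have "ring_hom_ring (rep_ring (Suc m) G) (rep_ring m G) ?\<pi>"
    using hom by (intro ring_hom_ringI2 ring_rep_ring)
  from ideal_surj_image[OF this J stabilise_pullback_surj[OF assms(1)]]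
  have "ideal (?\<pi> ` J_ideal (Suc m) G X) (rep_ring m G)" .
  moreover have "s_coord m G i j x \<in> ?\<pi> ` J_ideal (Suc m) G X" if "i < m" "j < m" "x \<in> X" for i j x
  proof (rule image_eqI)
    show "s_coord m G i j x = ?\<pi> (s_coord (Suc m) G i j x)"
      using that assms(2) stabilise_pullback_s_coord[OF assms(1), of i m j x] by auto
    show "s_coord (Suc m) G i j x \<in> J_ideal (Suc m) G X"
      using that by (fastforce simp: J_ideal_def genideal_def)
  qed
  ultimately show "J_ideal m G X \<subseteq> ?\<pi> ` J_ideal (Suc m) G X"
    unfolding J_ideal_def[of m] by (intro ring.genideal_minimal[OF ring_rep_ring]) auto
qed

text \<open>
  Restriction from degree \<open>m + 1\<close> intertwines the two actions, since adding a trivial block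
  commutes with precomposition by \<open>\<sigma>\<close>.
\<close>

theorem D_filt_Suc_subset:
  assumes "group G" "X \<subseteq> carrier G" "generate G X = carrier G"
  shows "D_filt (Suc m) G X k \<subseteq> D_filt m G X k"
proof
  fix \<sigma>
  assume "\<sigma> \<in> D_filt (Suc m) G X k"
  then have \<sigma>: "\<sigma> \<in> auto G"
    and triv: "\<And>f. f \<in> J_ideal (Suc m) G X \<Longrightarrow>
      (\<lambda>r\<in>reps (Suc m) G. act (Suc m) G \<sigma> f r - f r) \<in> J_power (Suc m) G X (Suc k)"
    by (auto simp: mem_D_filt_iff[OF assms])
  let ?\<pi> = "pullback (reps m G) (stabilise m G)"
  have \<phi>: "stabilise m G \<in> reps m G \<rightarrow> reps (Suc m) G"
    using stabilise_in_reps[OF assms(1)] by auto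
  have pow: "?\<pi> ` J_power (Suc m) G X (Suc k) \<subseteq> J_power m G X (Suc k)"
    using stabilise_pullback_J_ideal[OF assms(1,2), of m]
    by (intro ring_hom_J_power[OF assms(1,2) stabilise_pullback_hom[OF assms(1)]]) simp
  have "(\<lambda>r\<in>reps m G. act m G \<sigma> f r - f r) \<in> J_power m G X (Suc k)"
    if "f \<in> J_ideal m G X" for f
  proof -
    have "f \<in> ?\<pi> ` J_ideal (Suc m) G X"
      using that by (simp only: stabilise_pullback_J_ideal[OF assms(1,2)])
    then obtain g where g: "g \<in> J_ideal (Suc m) G X" "f = ?\<pi> g"
      by (elim imageE)
    have "?\<pi> (act (Suc m) G \<sigma> g) = act m G \<sigma> f"
      using \<phi> compose_reps[OF assms(1) _ \<sigma>, of _ m]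
      by (auto simp: g(2) act_def pullback_def stabilise_compose[OF \<sigma>] Pi_iff)
    then have "?\<pi> (\<lambda>r\<in>reps (Suc m) G. act (Suc m) G \<sigma> g r - g r)
        = (\<lambda>r\<in>reps m G. act m G \<sigma> f r - f r)"
      by (simp add: pullback_ops(3)[OF \<phi>] g(2))
    moreover have "?\<pi> (\<lambda>r\<in>reps (Suc m) G. act (Suc m) G \<sigma> g r - g r) \<in> J_power m G X (Suc k)"
      using pow triv[OF g(1)] by (rule subsetD[OF _ imageI])
    ultimately show ?thesis
      by (simp only:)
  qed
  then show "\<sigma> \<in> D_filt m G X k"
    using \<sigma> by (simp add: mem_D_filt_iff[OF assms])
qed


section \<open>Free groups\<close>

lemma generate_free_gens: "generate (free_group n) (free_gens n) = carrier (free_group n)"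
proof
  interpret group "free_group n" by (rule group_free_group)
  show "generate (free_group n) (free_gens n) \<subseteq> carrier (free_group n)"
    by (rule generate_incl[OF free_gens_subset])
  have letter: "[a] \<in> generate (free_group n) (free_gens n)" if a: "fst a < n" for a
  proof (cases "snd a")
    case True
    then have "[a] \<in> free_gens n"
      using a by (auto simp: free_gens_def image_iff prod_eq_iff)
    then show ?thesis
      by (rule generate.incl)
  next
    case False
    then have gen: "[letter_inv a] \<in> free_gens n"
      using a by (auto simp: free_gens_def image_iff letter_inv_def)
    have "inv\<^bsub>free_group n\<^esub> [letter_inv a] = [a]"
      using a by (intro inv_equality) (auto simp: free_group_def)
    then show ?thesis
      using generate.inv[OF gen, of "free_group n"] by simp
  qed
  have "w \<in> generate (free_group n) (free_gens n)"
    if "reduced w" "fst ` set w \<subseteq> {..<n}" for w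
    using that
  proof (induction w)
    case Nil
    then show ?case
      using generate.one[of "free_group n"] by (simp add: free_group_def)
  next
    case (Cons a w)
    have "[a] \<otimes>\<^bsub>free_group n\<^esub> w \<in> generate (free_group n) (free_gens n)"
      using Cons reduced_tl by (intro generate.eng letter) auto
    moreover have "[a] \<otimes>\<^bsub>free_group n\<^esub> w = a # w"
      using cancel_cons_reduced[OF Cons.prems(1)] by (simp add: free_group_def)
    ultimately show ?case
      by simp
  qed
  then show "carrier (free_group n) \<subseteq> generate (free_group n) (free_gens n)"
    by (auto simp: free_group_def)
qed

theorem theorem2:
  fixes n :: nat
  shows "(\<forall>k\<ge>1. \<forall>m\<ge>2.
            A_filt (free_group n) k \<subseteq> D_filt m (free_group n) (free_gens n) k) \<and>
         (\<forall>k\<ge>1. \<forall>m\<ge>2.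
            D_filt (m + 1) (free_group n) (free_gens n) k
              \<subseteq> D_filt m (free_group n) (free_gens n) k)"
  using A_filt_subset_D_filt[OF group_free_group free_gens_subset generate_free_gens]
    D_filt_Suc_subset[OF group_free_group free_gens_subset generate_free_gens]
  by simp

end
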